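(* Let $T$ be a tournament on $4$ or more vertices with a vertex $x$ of out-degree $1$, and let $y$ be the vertex with $x\rightarrow y$. Then $T$ is quadrangular if and only if all of the following hold: (1) $O(y)=V(T)\setminus\{x,y\}$; (2) $\gamma(T-\{x,y\})>2$; (3) $\gamma((T-\{x,y\})^{r})>2$; (4) $\delta^{+}(T-\{x,y\})\geq 2$; (5) $\delta^{-}(T-\{x,y\})\geq 2$.
   Context: A tournament $T$ is a loopless digraph in which for each pair of distinct vertices exactly one of $(u,v)$, $(v,u)$ is an arc; $u\rightarrow v$ means $(u,v)$ is an arc. $O(v)=\{u:v\rightarrow u\}$, $I(v)=\{u:u\rightarrow v\}$. A digraph is quadrangular if for all distinct $u,v$, $|O(u)\cap O(v)|\neq 1$ and $|I(u)\cap I(v)|\neq 1$. $T-\{x,y\}$ is the subtournament induced on $V(T)\setminus\{x,y\}$. The dual $T^{r}$ has the same vertices with $a\rightarrow b$ in $T^r$ iff $b\rightarrow a$ in $T$. $\delta^{+}$, $\delta^{-}$ denote minimum out-degree and minimum in-degree. A dominating set of a digraph $D$ is a set $S$ of vertices such that every vertex is in $S$ or dominated by some vertex of $S$; $\gamma(D)$ is the minimum size of a dominating set. *)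

theory Defs
  imports "Graph_Theory.Digraph_Component"
begin

locale tournament = digraph +
  assumes exactly_one_arc:
    "\<lbrakk>u \<in> verts G; v \<in> verts G; u \<noteq> v\<rbrakk> \<Longrightarrow> (u \<rightarrow> v) \<longleftrightarrow> \<not> (v \<rightarrow> u)"

definition out_set :: "('a,'b) pre_digraph \<Rightarrow> 'a \<Rightarrow> 'a set" where
  "out_set G v = {u \<in> verts G. v \<rightarrow>\<^bsub>G\<^esub> u}"

definition in_set :: "('a,'b) pre_digraph \<Rightarrow> 'a \<Rightarrow> 'a set" where
  "in_set G v = {u \<in> verts G. u \<rightarrow>\<^bsub>G\<^esub> v}"

definition quadrangular :: "('a,'b) pre_digraph \<Rightarrow> bool" where
  "quadrangular G \<longleftrightarrow> (\<forall>u \<in> verts G. \<forall>v \<in> verts G. u \<noteq> v \<longrightarrow>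
     card (out_set G u \<inter> out_set G v) \<noteq> 1 \<and> card (in_set G u \<inter> in_set G v) \<noteq> 1)"

definition dual :: "('a,'b) pre_digraph \<Rightarrow> ('a,'b) pre_digraph" where
  "dual G = \<lparr> verts = verts G, arcs = arcs G, tail = head G, head = tail G \<rparr>"

definition dominating_set :: "('a,'b) pre_digraph \<Rightarrow> 'a set \<Rightarrow> bool" where
  "dominating_set G S \<longleftrightarrow>
     S \<subseteq> verts G \<and> (\<forall>v \<in> verts G. v \<in> S \<or> (\<exists>s \<in> S. s \<rightarrow>\<^bsub>G\<^esub> v))"

(* Meaningful for finite digraphs only, since infinite sets have cardinality 0. *)
definition domination_number :: "('a,'b) pre_digraph \<Rightarrow> nat" where
  "domination_number G = (LEAST n. \<exists>S. dominating_set G S \<and> card S = n)"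

(* The minimum degrees are unspecified for the null digraph, where Min is applied to {}. *)
definition min_out_degree :: "('a,'b) pre_digraph \<Rightarrow> nat" where
  "min_out_degree G = Min (out_degree G ` verts G)"

definition min_in_degree :: "('a,'b) pre_digraph \<Rightarrow> nat" where
  "min_in_degree G = Min (in_degree G ` verts G)"

end

theory Submission
  imports Defs
begin

text \<open>
  Let \<open>W = V(T) - {x, y}\<close>. Every vertex of \<open>W\<close> dominates \<open>x\<close>, and comparing \<open>x\<close> with the
  vertices of \<open>W\<close> shows that quadrangularity forces \<open>y\<close> to dominate all of \<open>W\<close>. Then two distinct
  vertices of \<open>W\<close> always share the out-neighbour \<open>x\<close> and the in-neighbour \<open>y\<close>, so they need a
  further common out- and in-neighbour inside \<open>W\<close>; a pair consisting of \<open>y\<close> or \<open>x\<close> and a vertex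
  \<open>w\<close> of \<open>W\<close> only forbids the out-degree, respectively in-degree, of \<open>w\<close> in \<open>W\<close> to be 1. A pair
  without a common in-neighbour is the same as a dominating set of size at most 2.
\<close>

section \<open>Duals, induced subdigraphs, domination number and degrees\<close>

lemma dominates_dual [simp]: "u \<rightarrow>\<^bsub>dual G\<^esub> v \<longleftrightarrow> v \<rightarrow>\<^bsub>G\<^esub> u"
  by (auto simp: dual_def arcs_ends_def arc_to_ends_def)

lemma verts_dual [simp]: "verts (dual G) = verts G"
  by (simp add: dual_def)

lemma in_set_dual [simp]: "in_set (dual G) = out_set G"
  by (simp add: in_set_def out_set_def fun_eq_iff)

lemma min_in_degree_dual [simp]: "min_in_degree (dual G) = min_out_degree G"
  by (simp add: min_in_degree_def min_out_degree_def in_degree_def out_degree_def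
      in_arcs_def out_arcs_def dual_def)

lemma dominates_induce_subgraph_iff:
  "u \<rightarrow>\<^bsub>G \<restriction> S\<^esub> v \<longleftrightarrow> u \<in> S \<and> v \<in> S \<and> u \<rightarrow>\<^bsub>G\<^esub> v"
  by (auto simp: arcs_ends_def arc_to_ends_def)

text \<open>The whole vertex set always dominates, so the \<open>LEAST\<close> is attained by an
  actual dominating set.\<close>

lemma less_domination_number_iff:
  "k < domination_number G \<longleftrightarrow> (\<forall>S. dominating_set G S \<longrightarrow> k < card S)"
proof
  assume "k < domination_number G"
  then show "\<forall>S. dominating_set G S \<longrightarrow> k < card S"
    unfolding domination_number_def
    by (metis (mono_tags, lifting) Least_le order_less_le_trans)
next
  assume *: "\<forall>S. dominating_set G S \<longrightarrow> k < card S"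
  have "dominating_set G (verts G)"
    by (simp add: dominating_set_def)
  then have "\<exists>n S. dominating_set G S \<and> card S = n"
    by blast
  then have "\<exists>S. dominating_set G S \<and> card S = domination_number G"
    unfolding domination_number_def by (rule LeastI_ex)
  with * show "k < domination_number G"
    by auto
qed

text \<open>Degrees count arcs while quadrangularity counts vertices; without parallel arcs,
  \<open>head G\<close> is injective on the arcs leaving \<open>v\<close>, so the counts
  agree.\<close>

lemma (in nomulti_digraph) out_degree_eq_card_out_set: "out_degree G v = card (out_set G v)"
proof -
  have "out_set G v = head G ` out_arcs G v"
    by (auto simp: out_set_def arcs_ends_def arc_to_ends_def)
  moreover have "inj_on (head G) (out_arcs G v)"
    by (auto intro!: inj_onI no_multi_arcs simp: arc_to_ends_def)
  ultimately show ?thesis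
    by (simp add: out_degree_def card_image)
qed

lemma (in nomulti_digraph) in_degree_eq_card_in_set: "in_degree G v = card (in_set G v)"
proof -
  have "in_set G v = tail G ` in_arcs G v"
    by (auto simp: in_set_def arcs_ends_def arc_to_ends_def)
  moreover have "inj_on (tail G) (in_arcs G v)"
    by (auto intro!: inj_onI no_multi_arcs simp: arc_to_ends_def)
  ultimately show ?thesis
    by (simp add: in_degree_def card_image)
qed

section \<open>Tournaments and domination by at most two vertices\<close>

context tournament
begin

lemma not_dominates_self: "\<not> v \<rightarrow> v"
  using no_loops by (auto simp: arcs_ends_def arc_to_ends_def)

lemma finite_out_set: "finite (out_set G v)" and finite_in_set: "finite (in_set G v)"
  by (simp_all add: out_set_def in_set_def)

text \<open>Allows each result on in-neighbours to be transferred to out-neighbours.\<close>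

lemma tournament_dual: "tournament (dual G)"
proof
  fix u v assume "u \<in> verts (dual G)" "v \<in> verts (dual G)" "u \<noteq> v"
  then show "u \<rightarrow>\<^bsub>dual G\<^esub> v \<longleftrightarrow> \<not> v \<rightarrow>\<^bsub>dual G\<^esub> u"
    using exactly_one_arc[of v u] by auto
next
  fix e assume "e \<in> arcs (dual G)"
  then show "tail (dual G) e \<noteq> head (dual G) e"
    using no_loops by (fastforce simp: dual_def)
next
  fix e f assume "e \<in> arcs (dual G)" "f \<in> arcs (dual G)"
    "arc_to_ends (dual G) e = arc_to_ends (dual G) f"
  then show "e = f"
    by (auto intro: no_multi_arcs simp: dual_def arc_to_ends_def)
qed (auto simp: dual_def)

lemma tournament_induce_subgraph:
  assumes "S \<subseteq> verts G"
  shows "tournament (G \<restriction> S)"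
proof -
  interpret H: digraph "G \<restriction> S"
    using assms by (intro digraphI_induced induced_induce)
  show ?thesis
  proof
    fix u v assume "u \<in> verts (G \<restriction> S)" "v \<in> verts (G \<restriction> S)" "u \<noteq> v"
    with assms have "u \<in> S" "v \<in> S" "u \<rightarrow> v \<longleftrightarrow> \<not> v \<rightarrow> u"
      using exactly_one_arc[of u v] by auto
    then show "u \<rightarrow>\<^bsub>G \<restriction> S\<^esub> v \<longleftrightarrow> \<not> v \<rightarrow>\<^bsub>G \<restriction> S\<^esub> u"
      by (simp only: dominates_induce_subgraph_iff simp_thms)
  qed
qed

text \<open>In a tournament, a vertex outside \<open>{u, v}\<close> dominated by neither
  \<open>u\<close> nor \<open>v\<close> dominates both. The case \<open>u = v\<close> is included on
  purpose: it accounts for one-element dominating sets.\<close>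

lemma two_less_domination_number_iff:
  assumes "verts G \<noteq> {}"
  shows "2 < domination_number G \<longleftrightarrow>
    (\<forall>u \<in> verts G. \<forall>v \<in> verts G. in_set G u \<inter> in_set G v \<noteq> {})" (is "?L \<longleftrightarrow> ?R")
proof
  assume L: ?L
  show ?R
  proof (intro ballI)
    fix u v assume uv: "u \<in> verts G" "v \<in> verts G"
    have "card {u, v} \<le> 2"
      by (simp add: card_insert_if)
    with L have "\<not> dominating_set G {u, v}"
      unfolding less_domination_number_iff by (meson leD)
    then obtain w where "w \<in> verts G" "w \<noteq> u" "w \<noteq> v" "\<not> u \<rightarrow> w" "\<not> v \<rightarrow> w"
      using uv by (auto simp: dominating_set_def)
    then have "w \<in> in_set G u \<inter> in_set G v"
      using uv exactly_one_arc[of u w] exactly_one_arc[of v w] by (auto simp: in_set_def)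
    then show "in_set G u \<inter> in_set G v \<noteq> {}"
      by blast
  qed
next
  assume R: ?R
  show ?L
    unfolding less_domination_number_iff
  proof (intro allI impI, rule ccontr)
    fix S assume S: "dominating_set G S" and "\<not> 2 < card S"
    \<comment> \<open>Since \<open>G\<close> has a vertex, the empty set does not dominate;
      finiteness ensures that cardinality 0 would mean empty.\<close>
    then have "finite S" "S \<noteq> {}"
      using assms finite_subset[OF _ finite_verts] by (auto simp: dominating_set_def)
    then have "card S = 1 \<or> card S = 2"
      using \<open>\<not> 2 < card S\<close> card_0_eq[of S] by linarith
    \<comment> \<open>A singleton is read as \<open>{u, u}\<close>.\<close>
    then obtain u v where uv: "S = {u, v}"
      by (metis card_1_singletonE card_2_iff insert_absorb2)
    then have "u \<in> verts G" "v \<in> verts G"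
      using S by (auto simp: dominating_set_def)
    with R obtain w where w: "w \<in> verts G" "w \<rightarrow> u" "w \<rightarrow> v"
      by (fastforce simp: in_set_def)
    \<comment> \<open>Hence \<open>w\<close> lies outside \<open>S\<close> and must be dominated by
      \<open>u\<close> or \<open>v\<close>, against the direction of its arcs to both.\<close>
    then have "w \<noteq> u" "w \<noteq> v"
      using not_dominates_self by auto
    with S w uv have "u \<rightarrow> w \<or> v \<rightarrow> w"
      by (auto simp: dominating_set_def)
    with w \<open>w \<noteq> u\<close> \<open>w \<noteq> v\<close> \<open>u \<in> verts G\<close> \<open>v \<in> verts G\<close> show False
      using exactly_one_arc[of w u] exactly_one_arc[of w v] by blast
  qed
qed

text \<open>Quadrangularity speaks of distinct pairs and degrees different from 1, whereas
  domination includes \<open>u = v\<close> and the degree bound is 2. The gap closes only for the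
  conjunction: a common in-neighbour with a second vertex makes every in-degree positive, which
  settles \<open>u = v\<close> and turns "not 1" into "at least 2".\<close>

lemma domination_number_and_min_in_degree_iff:
  assumes "2 \<le> card (verts G)"
  shows "2 < domination_number G \<and> 2 \<le> min_in_degree G \<longleftrightarrow>
    (\<forall>u \<in> verts G. \<forall>v \<in> verts G. u \<noteq> v \<longrightarrow> in_set G u \<inter> in_set G v \<noteq> {}) \<and>
    (\<forall>v \<in> verts G. card (in_set G v) \<noteq> 1)" (is "_ \<longleftrightarrow> ?P \<and> ?D")
proof -
  have ne: "verts G \<noteq> {}"
    using assms by auto
  have deg: "2 \<le> min_in_degree G \<longleftrightarrow> (\<forall>v \<in> verts G. 2 \<le> card (in_set G v))"
    using ne by (simp add: min_in_degree_def in_degree_eq_card_in_set)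
  have nonempty: "in_set G v \<noteq> {}" if "?P" "v \<in> verts G" for v
  proof -
    have "\<not> verts G \<subseteq> {v}"
      using assms card_mono[of "{v}" "verts G"] by auto
    then obtain u where "u \<in> verts G" "u \<noteq> v"
      by blast
    with that show ?thesis
      by blast
  qed
  have two: "2 \<le> card (in_set G v)" if "?P" "?D" "v \<in> verts G" for v
  proof -
    have "card (in_set G v) \<noteq> 0" "card (in_set G v) \<noteq> 1"
      using that nonempty finite_in_set by auto
    then show ?thesis by linarith
  qed
  have common: "in_set G u \<inter> in_set G v \<noteq> {}" if "?P" "u \<in> verts G" "v \<in> verts G" for u v
    using that nonempty by (cases "u = v") auto
  show ?thesis
    unfolding two_less_domination_number_iff[OF ne] deg
  proof (rule iffI)
    assume *: "(\<forall>u \<in> verts G. \<forall>v \<in> verts G. in_set G u \<inter> in_set G v \<noteq> {}) \<and>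
      (\<forall>v \<in> verts G. 2 \<le> card (in_set G v))"
    then have "card (in_set G v) \<noteq> 1" if "v \<in> verts G" for v
      using that by (metis numeral_le_one_iff semiring_norm(69))
    with * show "?P \<and> ?D" by simp
  next
    assume "?P \<and> ?D"
    then show "(\<forall>u \<in> verts G. \<forall>v \<in> verts G. in_set G u \<inter> in_set G v \<noteq> {}) \<and>
      (\<forall>v \<in> verts G. 2 \<le> card (in_set G v))"
      by (intro conjI ballI common two) simp_all
  qed
qed

end

section \<open>Tournaments with a vertex of out-degree 1\<close>

theorem theorem7:
  fixes T :: "('a,'b) pre_digraph" and x y :: 'a
  assumes "tournament T"
    and "card (verts T) \<ge> 4"
    and "x \<in> verts T"
    and "out_degree T x = 1"
    and "x \<rightarrow>\<^bsub>T\<^esub> y"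
  shows "quadrangular T \<longleftrightarrow>
      out_set T y = verts T - {x, y}
    \<and> domination_number (T \<restriction> (verts T - {x, y})) > 2
    \<and> domination_number (dual (T \<restriction> (verts T - {x, y}))) > 2
    \<and> min_out_degree (T \<restriction> (verts T - {x, y})) \<ge> 2
    \<and> min_in_degree (T \<restriction> (verts T - {x, y})) \<ge> 2"
proof -
  interpret T: tournament T by fact
  define W where "W = verts T - {x, y}"
  define H where "H = T \<restriction> W"
  have WV: "W \<subseteq> verts T"
    by (auto simp: W_def)
  interpret H: tournament H
    unfolding H_def using WV by (rule T.tournament_induce_subgraph)
  interpret Hr: tournament "dual H"
    by (rule H.tournament_dual)
  have vH [simp]: "verts H = W"
    by (simp add: H_def)
  have y: "y \<in> verts T" "x \<noteq> y" "\<not> y \<rightarrow>\<^bsub>T\<^esub> x"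
    using assms(3,5) T.exactly_one_arc[of x y] T.not_dominates_self T.adj_in_verts(2) by auto
  have cW: "2 \<le> card (verts H)"
    using assms(2,3) y by (simp add: W_def card_Diff_subset)
  have Ox: "out_set T x = {y}"
  proof -
    have "card (out_set T x) = 1"
      using assms(4) by (simp add: T.out_degree_eq_card_out_set)
    moreover have "y \<in> out_set T x"
      using y assms(5) by (simp add: out_set_def)
    ultimately show ?thesis
      by (auto simp: card_1_singleton_iff)
  qed
  have Wx: "w \<rightarrow>\<^bsub>T\<^esub> x \<and> \<not> x \<rightarrow>\<^bsub>T\<^esub> w" if "w \<in> W" for w
  proof -
    have "w \<in> verts T" "w \<noteq> x" "w \<notin> out_set T x"
      using that Ox by (auto simp: W_def)
    then show ?thesis
      using T.exactly_one_arc[of w x] assms(3) by (auto simp: out_set_def)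
  qed
  have Ix: "in_set T x = W"
    using Wx y T.not_dominates_self by (auto simp: in_set_def W_def)
  have forced: "out_set T y = W" if "quadrangular T"
  proof -
    have "y \<rightarrow>\<^bsub>T\<^esub> w" if "w \<in> W" for w
    proof (rule ccontr)
      assume "\<not> y \<rightarrow>\<^bsub>T\<^esub> w"
      then have "y \<in> out_set T w"
        using that y T.exactly_one_arc[of y w] by (auto simp: W_def out_set_def)
      \<comment> \<open>As \<open>y\<close> is the only out-neighbour of \<open>x\<close>, it would
        be the only common one.\<close>
      then have "card (out_set T x \<inter> out_set T w) = 1"
        using Ox by simp
      then show False
        using \<open>quadrangular T\<close> that assms(3) by (auto simp: quadrangular_def W_def)
    qed
    then show ?thesis
      using y T.not_dominates_self by (auto simp: out_set_def W_def)
  qed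
  have reduction: "quadrangular T \<longleftrightarrow>
      (\<forall>u \<in> W. \<forall>v \<in> W. u \<noteq> v \<longrightarrow> in_set H u \<inter> in_set H v \<noteq> {}) \<and>
      (\<forall>v \<in> W. card (in_set H v) \<noteq> 1) \<and>
      (\<forall>u \<in> W. \<forall>v \<in> W. u \<noteq> v \<longrightarrow> out_set H u \<inter> out_set H v \<noteq> {}) \<and>
      (\<forall>v \<in> W. card (out_set H v) \<noteq> 1)"
    if Oy: "out_set T y = W"
  proof -
    have V: "verts T = insert x (insert y W)"
      using assms(3) y by (auto simp: W_def)
    have xyW: "x \<notin> W" "y \<notin> W"
      by (auto simp: W_def)
    have Wy: "\<not> w \<rightarrow>\<^bsub>T\<^esub> y" if "w \<in> W" for w
      using that Oy y T.exactly_one_arc[of y w] by (auto simp: W_def out_set_def)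
    have Iy: "in_set T y = {x}"
      using Wy assms(3,5) T.not_dominates_self by (auto simp: in_set_def V)
    have O: "out_set T w = insert x (out_set H w)" if "w \<in> W" for w
      using that Wx Wy assms(3) by (auto simp: H_def dominates_induce_subgraph_iff out_set_def V)
    have yW: "y \<rightarrow>\<^bsub>T\<^esub> w" if "w \<in> W" for w
      using that Oy by (auto simp: out_set_def)
    have I: "in_set T w = insert y (in_set H w)" if "w \<in> W" for w
      using that Wx yW y by (auto simp: H_def dominates_induce_subgraph_iff in_set_def V)
    have sub: "out_set H w \<subseteq> W" "in_set H w \<subseteq> W" for w
      by (auto simp: out_set_def in_set_def)
    \<comment> \<open>The common out-set in \<open>T\<close> is that of \<open>H\<close> with the
      new element \<open>x\<close> added, so it has size 1 exactly when nothing is common in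
      \<open>H\<close>; likewise with \<open>y\<close> for in-sets.\<close>
    have pairs: "card (out_set T u \<inter> out_set T v) \<noteq> 1 \<longleftrightarrow> out_set H u \<inter> out_set H v \<noteq> {}"
      "card (in_set T u \<inter> in_set T v) \<noteq> 1 \<longleftrightarrow> in_set H u \<inter> in_set H v \<noteq> {}"
      if "u \<in> W" "v \<in> W" for u v
    proof -
      have "x \<notin> out_set H u \<inter> out_set H v" "y \<notin> in_set H u \<inter> in_set H v"
        using sub xyW by blast+
      then show "card (out_set T u \<inter> out_set T v) \<noteq> 1 \<longleftrightarrow> out_set H u \<inter> out_set H v \<noteq> {}"
        "card (in_set T u \<inter> in_set T v) \<noteq> 1 \<longleftrightarrow> in_set H u \<inter> in_set H v \<noteq> {}"
        using that H.finite_out_set H.finite_in_set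
        by (simp_all add: O I flip: Int_insert_right)
    qed
    \<comment> \<open>The pair \<open>x\<close>, \<open>y\<close> imposes no condition, since 0
      common neighbours are allowed.\<close>
    have mixed: "out_set T x \<inter> out_set T y = {}" "in_set T x \<inter> in_set T y = {}"
      using Ox Oy Ix Iy xyW by auto
    have mixed_x: "out_set T x \<inter> out_set T w = {}" "in_set T x \<inter> in_set T w = in_set H w"
      and mixed_y: "out_set T y \<inter> out_set T w = out_set H w" "in_set T y \<inter> in_set T w = {}"
      if "w \<in> W" for w
      using that sub[of w] xyW y(2) by (auto simp: Ox Oy Ix Iy O I)
    have "quadrangular T \<longleftrightarrow>
      (\<forall>v \<in> W. card (in_set H v) \<noteq> 1 \<and> card (out_set H v) \<noteq> 1) \<and>
      (\<forall>u \<in> W. \<forall>v \<in> W. u \<noteq> v \<longrightarrow>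
        card (out_set T u \<inter> out_set T v) \<noteq> 1 \<and> card (in_set T u \<inter> in_set T v) \<noteq> 1)"
    proof -
      have "u \<noteq> x" "u \<noteq> y" if "u \<in> W" for u
        using that xyW by auto
      then show ?thesis
        unfolding quadrangular_def V using mixed mixed_x mixed_y y(2)
        by (auto simp: Int_commute)
    qed
    also have "\<dots> \<longleftrightarrow>
      (\<forall>v \<in> W. card (in_set H v) \<noteq> 1 \<and> card (out_set H v) \<noteq> 1) \<and>
      (\<forall>u \<in> W. \<forall>v \<in> W. u \<noteq> v \<longrightarrow>
        out_set H u \<inter> out_set H v \<noteq> {} \<and> in_set H u \<inter> in_set H v \<noteq> {})"
      using pairs by (simp cong: ball_cong)
    finally show ?thesis
      by (simp only: imp_conjR ball_conj_distrib conj_ac)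
  qed
  have in_iff: "2 < domination_number H \<and> 2 \<le> min_in_degree H \<longleftrightarrow>
      (\<forall>u \<in> W. \<forall>v \<in> W. u \<noteq> v \<longrightarrow> in_set H u \<inter> in_set H v \<noteq> {}) \<and>
      (\<forall>v \<in> W. card (in_set H v) \<noteq> 1)"
    using H.domination_number_and_min_in_degree_iff[OF cW] by (simp only: vH)
  \<comment> \<open>The same lemma applied to \<open>dual H\<close>, whose in-sets are the out-sets
    of \<open>H\<close>.\<close>
  have out_iff: "2 < domination_number (dual H) \<and> 2 \<le> min_out_degree H \<longleftrightarrow>
      (\<forall>u \<in> W. \<forall>v \<in> W. u \<noteq> v \<longrightarrow> out_set H u \<inter> out_set H v \<noteq> {}) \<and>
      (\<forall>v \<in> W. card (out_set H v) \<noteq> 1)"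
    using Hr.domination_number_and_min_in_degree_iff cW
    by (simp only: verts_dual vH in_set_dual min_in_degree_dual)
  have "quadrangular T \<longleftrightarrow>
      out_set T y = W \<and> 2 < domination_number H \<and> 2 < domination_number (dual H)
      \<and> 2 \<le> min_out_degree H \<and> 2 \<le> min_in_degree H"
  proof (cases "out_set T y = W")
    case True
    show ?thesis
      unfolding reduction[OF True] using True in_iff out_iff by argo
  next
    \<comment> \<open>Here both sides fail: the right one by its first conjunct, the left one by the
      contrapositive of \<open>forced\<close>.\<close>
    case False
    with forced show ?thesis by blast
  qed
  then show ?thesis
    by (simp only: H_def W_def)
qed

end
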